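(* For all integers $k\geq 2$ and $\ell\geq 1$, \[ f_2(k,\ell)\leq 6^\ell k^\ell(k+1)^\ell(k+2)^\ell. \]
   Context: A 2-coloring of a set $A\subseteq\mathbb{N}$ is a function $\Delta:A\to\{0,1\}$. For integers $r,k\geq 2$ and $\ell\geq 1$, $f_r(k,\ell)$ denotes the smallest positive integer $n$ such that every $r$-coloring $\Delta$ of $\{1,2,\ldots,n\}$ has a monochromatic solution to $1/x_1^{1/\ell}+\cdots+1/x_k^{1/\ell}=1/y^{1/\ell}$, i.e. elements $a_1,\ldots,a_k,b$ (with $a_1,\ldots,a_k$ not necessarily distinct) satisfying the equation and $\Delta(a_1)=\cdots=\Delta(a_k)=\Delta(b)$. *)

theory Defs
  imports Complex_Main "HOL-Library.FuncSet" "HOL-Library.Extended_Nat"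
begin

definition coloring :: "nat \<Rightarrow> nat set \<Rightarrow> (nat \<Rightarrow> nat) \<Rightarrow> bool" where
  "coloring r A \<Delta> \<longleftrightarrow> \<Delta> \<in> A \<rightarrow> {0..<r}"

definition has_mono_solution :: "nat \<Rightarrow> nat \<Rightarrow> nat set \<Rightarrow> (nat \<Rightarrow> nat) \<Rightarrow> bool" where
  "has_mono_solution k l A \<Delta> \<longleftrightarrow>
     (\<exists>a b. (\<forall>i\<in>{1..k}. a i \<in> A) \<and> b \<in> A \<and>
            (\<Sum>i=1..k. 1 / real (a i) powr (1 / real l)) = 1 / real b powr (1 / real l) \<and>
            (\<forall>i\<in>{1..k}. \<Delta> (a i) = \<Delta> b))"

text \<open>The least such \<open>n\<close>, taken in the extended naturals so that the value is \<open>\<infinity>\<close> if there is none;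
  a finite upper bound therefore includes the existence of such an \<open>n\<close>.\<close>

definition f :: "nat \<Rightarrow> nat \<Rightarrow> nat \<Rightarrow> enat" where
  "f r k l = Inf (enat ` {n. n \<ge> 1 \<and>
     (\<forall>\<Delta>. coloring r {1..n} \<Delta> \<longrightarrow> has_mono_solution k l {1..n} \<Delta>)})"

end

theory Submission
  imports Defs
begin

text \<open>
  Restrict the colouring to the numbers \<open>(N div d) ^ l\<close> with \<open>d\<close> a divisor of \<open>N\<close>. The reciprocal of
  the \<open>l\<close>-th root of such a number is \<open>d / N\<close>, so it suffices to find a monochromatic solution of
  \<open>x\<^sub>1 + \<dots> + x\<^sub>k = y\<close> among the divisors of \<open>N\<close>. For \<open>k \<ge> 3\<close> take \<open>N = 6 k (k + 1) (k + 2)\<close>; then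
  assuming that there is none forces colours on divisors such as \<open>1, 2, k, 2 k, k + 1, 6 k\<close> until a
  contradiction arises. For \<open>k = 2\<close> the divisors \<open>1, \<dots>, 5\<close> of \<open>N = 60\<close> suffice.
\<close>

text \<open>Every solution used later has at most three distinct summands, listed in consecutive
  blocks of lengths \<open>p\<close>, \<open>q\<close> and \<open>r\<close>.\<close>

lemma sum_three_blocks:
  fixes x y z :: real
  shows "(\<Sum>i=1..p+q+r. if i \<le> p then x else if i \<le> p + q then y else z)
           = real p * x + real q * y + real r * z"
proof (induction r)
  case 0
  have "(\<Sum>i=1..p+q. if i \<le> p then x else if i \<le> p + q then y else z)
          = real p * x + real q * y"
  proof -
    have "(\<Sum>i=1..p+q. if i \<le> p then x else if i \<le> p + q then y else z)
            = (\<Sum>i=1..p+q. if i \<le> p then x else y)"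
      by (rule sum.cong) auto
    also have "\<dots> = real p * x + real q * y"
      by (induction q) (simp_all add: algebra_simps)
    finally show ?thesis .
  qed
  then show ?case by simp
next
  case (Suc r)
  then show ?case by (simp add: algebra_simps)
qed

lemma inverse_root_codivisor:
  assumes "d dvd N" and "N > 0" and "l \<ge> 1"
  shows "1 / real ((N div d) ^ l) powr (1 / real l) = real d / real N"
proof -
  obtain m where m: "N = d * m" using assms(1) by blast
  then have "d > 0" "m > 0" using assms(2) by auto
  have "real (m ^ l) powr (1 / real l) = real m"
    using \<open>m > 0\<close> assms(3) by (simp add: powr_powr flip: powr_realpow)
  then show ?thesis using m \<open>d > 0\<close> \<open>m > 0\<close> by simp
qed

text \<open>Dividing \<open>y = p * u + q * v + r * w\<close> by \<open>N\<close> gives the equation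
  between reciprocal roots. Since \<open>N ^ l \<le> n\<close> suffices, \<open>N\<close> may be
  chosen separately for small \<open>k\<close>.\<close>

lemma has_mono_solution_of_divisors:
  fixes \<Delta> :: "nat \<Rightarrow> nat"
  assumes "l \<ge> 1" and "N > 0" and "N ^ l \<le> n" and k: "k = p + q + r"
    and y: "y = p * u + q * v + r * w"
    and dvd: "u dvd N" "v dvd N" "w dvd N" "y dvd N"
    and mono: "\<And>d. d \<in> {u, v, w} \<Longrightarrow> \<Delta> ((N div d) ^ l) = \<Delta> ((N div y) ^ l)"
  shows "has_mono_solution k l {1..n} \<Delta>"
proof -
  define e where "e i = (if i \<le> p then u else if i \<le> p + q then v else w)" for i
  define g where "g d = (N div d) ^ l" for d
  have e: "e i \<in> {u, v, w}" for i by (auto simp: e_def)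
  have mem: "g d \<in> {1..n}" if "d dvd N" for d
  proof -
    have "N div d > 0" using that assms(2) by (auto elim!: dvdE)
    moreover have "(N div d) ^ l \<le> N ^ l" by (simp add: power_mono)
    ultimately show ?thesis using assms(3) by (auto simp: g_def Suc_le_eq)
  qed
  have recip: "1 / real (g d) powr (1 / real l) = real d / real N" if "d dvd N" for d
    unfolding g_def by (rule inverse_root_codivisor[OF that assms(2,1)])
  have edvd: "e i dvd N" for i using dvd by (auto simp: e_def)
  have "(\<Sum>i=1..k. 1 / real (g (e i)) powr (1 / real l))
          = (\<Sum>i=1..k. real (e i) / real N)"
    by (intro sum.cong refl recip edvd)
  also have "\<dots> = (\<Sum>i=1..p+q+r. if i \<le> p then real u else if i \<le> p + q then real v else real w) / real N"
    unfolding k sum_divide_distrib by (rule sum.cong) (auto simp: e_def)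
  also have "\<dots> = real y / real N"
    by (simp only: sum_three_blocks y of_nat_add of_nat_mult)
  also have "\<dots> = 1 / real (g y) powr (1 / real l)"
    by (rule recip[symmetric]) (rule dvd)
  finally have "(\<Sum>i=1..k. 1 / real (g (e i)) powr (1 / real l)) = 1 / real (g y) powr (1 / real l)" .
  moreover have "\<Delta> (g (e i)) = \<Delta> (g y)" for i using mono[OF e] by (simp add: g_def)
  ultimately show ?thesis
    unfolding has_mono_solution_def using mem edvd dvd(4)
    by (intro exI[of _ "\<lambda>i. g (e i)"] exI[of _ "g y"]) auto
qed

text \<open>One of the consecutive numbers \<open>k + 1\<close> and \<open>k + 2\<close> is even,
  which supplies the second factor 2.\<close>

lemma four_mult_dvd_six_mult: "4 * k dvd 6 * k * (k + 1) * (k + 2 :: nat)"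
proof -
  have "2 dvd (k + 1) * (k + 2)" by simp
  then obtain m where "(k + 1) * (k + 2) = 2 * m" by blast
  then have "6 * k * (k + 1) * (k + 2) = 4 * k * (3 * m)" by algebra
  then show ?thesis by simp
qed

text \<open>\<open>P\<close> is one of the two colour classes. Some of the equations use a summand
  \<open>k - 3\<close> times, hence \<open>k \<ge> 3\<close>.\<close>

lemma two_coloring_divisors:
  fixes P :: "nat \<Rightarrow> bool" and k N :: nat
  assumes k: "k \<ge> 3" and N: "N = 6 * k * (k + 1) * (k + 2)"
    and free: "\<And>p q r u v w y. \<lbrakk>k = p + q + r; y = p * u + q * v + r * w;
        u dvd N; v dvd N; w dvd N; y dvd N; P u = P y; P v = P y; P w = P y\<rbrakk> \<Longrightarrow> False"
  shows False
proof -
  \<comment> \<open>Multiplicities such as \<open>k - 3\<close> become \<open>j\<close>, which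
    avoids truncated subtraction.\<close>
  obtain j where j: "k = j + 3" using k by (metis add.commute le_Suc_ex)
  \<comment> \<open>Apart from 4 and \<open>4 * k\<close>, every divisor needed divides one of the
    three in \<open>d1\<close>.\<close>
  have "N = 6 * k * ((k + 1) * (k + 2))" "N = 3 * k * (k + 1) * (2 * (k + 2))"
      "N = 2 * k * (k + 2) * (3 * (k + 1))"
    unfolding N by algebra+
  then have d1: "6 * k dvd N" "3 * k * (k + 1) dvd N" "2 * k * (k + 2) dvd N"
    by (metis dvd_triv_left)+
  have "2 * k dvd 6 * k" by (rule mult_dvd_mono) simp_all
  then have d2: "1 dvd N" "2 dvd N" "6 dvd N" "k dvd N" "2 * k dvd N"
    using d1(1) by (auto intro: dvd_mult_left dvd_mult_right dvd_trans)
  have d3: "k + 1 dvd N" "k * (k + 1) dvd N" "3 * (k + 1) dvd N"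
    using d1(2) by (metis dvd_mult_right mult.assoc mult.left_commute)+
  have d4: "k * (k + 2) dvd N" "2 * (k + 2) dvd N"
    using d1(3) by (metis dvd_mult_right mult.assoc mult.left_commute)+
  have "4 dvd N" "4 * k dvd N"
    using four_mult_dvd_six_mult[of k, folded N] by (auto intro: dvd_mult_left)
  note d = this d1 d2 d3 d4
  define mono where "mono u v w y \<longleftrightarrow> P u = P y \<and> P v = P y \<and> P w = P y" for u v w y
  have step: "\<not> mono u v w y" if "k = p + q + r" "y = p * u + q * v + r * w"
      "u dvd N" "v dvd N" "w dvd N" "y dvd N" for p q r u v w y
    using free[OF that] unfolding mono_def by blast
  \<comment> \<open>An empty block still carries a colour condition, so its value repeats one that
    occurs.\<close>
  have m1: "\<not> mono 1 1 1 k"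
    by (rule step[of "j + 3" 0 0]; (rule d | simp add: j algebra_simps))
  have m2: "\<not> mono 2 2 2 (2 * k)"
    by (rule step[of "j + 3" 0 0]; (rule d | simp add: j algebra_simps))
  have m3: "\<not> mono (k + 1) (k + 1) (k + 1) (k * (k + 1))"
    by (rule step[of "j + 3" 0 0]; (rule d | simp add: j algebra_simps))
  have m6: "\<not> mono 6 6 6 (6 * k)"
    by (rule step[of "j + 3" 0 0]; (rule d | simp add: j algebra_simps))
  have a1: "\<not> mono k (2 * k) k (k * (k + 2))"
    by (rule step[of "j + 1" 2 0]; (rule d | simp add: j algebra_simps))
  have a2: "\<not> mono k (2 * k) k (k * (k + 1))"
    by (rule step[of "j + 2" 1 0]; (rule d | simp add: j algebra_simps))
  have a3: "\<not> mono (k * (k + 1)) 1 2 (k * (k + 2))"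
    by (rule step[of 1 "j + 1" 1]; (rule d | simp add: j algebra_simps))
  have b1: "\<not> mono 1 (k + 1) 1 (2 * k)"
    by (rule step[of "j + 2" 1 0]; (rule d | simp add: j algebra_simps))
  have b2: "\<not> mono 2 6 2 (2 * (k + 2))"
    by (rule step[of "j + 2" 1 0]; (rule d | simp add: j algebra_simps))
  have b3: "\<not> mono (2 * (k + 2)) 4 (2 * (k + 2)) (6 * k)"
    by (rule step[of 1 "j + 2" 0]; (rule d | simp add: j algebra_simps))
  have b4: "\<not> mono (2 * k) (6 * k) (2 * k) (2 * k * (k + 2))"
    by (rule step[of "j + 2" 1 0]; (rule d | simp add: j algebra_simps))
  have b5: "\<not> mono (2 * k * (k + 2)) (k + 1) 2 (3 * k * (k + 1))"
    by (rule step[of 1 "j + 1" 1]; (rule d | simp add: j algebra_simps))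
  have b6: "\<not> mono (k + 1) 2 4 (4 * k)"
    by (rule step[of 2 j 1]; (rule d | simp add: j algebra_simps))
  have b7: "\<not> mono (k * (k + 1)) (2 * k) (4 * k) (3 * k * (k + 1))"
    by (rule step[of 1 j 2]; (rule d | simp add: j algebra_simps))
  have c1: "\<not> mono (k + 1) 2 (2 * (k + 2)) (6 * k)"
    by (rule step[of 2 j 1]; (rule d | simp add: j algebra_simps))
  have c2: "\<not> mono (k + 1) 2 (3 * (k + 1)) (6 * k)"
    by (rule step[of 1 "j + 1" 1]; (rule d | simp add: j algebra_simps))
  have c3: "\<not> mono (2 * (k + 2)) 1 (2 * (k + 2)) (3 * (k + 1))"
    by (rule step[of 1 "j + 2" 0]; (rule d | simp add: j algebra_simps))
  \<comment> \<open>If \<open>P (2 * k) \<noteq> P 1\<close>, the facts \<open>a\<close> conflict; otherwise the facts \<open>b\<close> conflict when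
    \<open>P (6 * k) = P 1\<close>, and the facts \<open>c\<close> when \<open>P (6 * k) \<noteq> P 1\<close>.\<close>
  show False
    using m1 m2 m3 m6 a1 a2 a3 b1 b2 b3 b4 b5 b6 b7 c1 c2 c3 unfolding mono_def by argo
qed

text \<open>From 1+1=2, 2+2=4 and 1+4=5, the numbers 1 and 4 share a colour, and 2 and 5 have the
  other. Then 3 can take neither, by 1+3=4 and 2+3=5.\<close>

lemma two_coloring_divisors_sixty:
  fixes P :: "nat \<Rightarrow> bool"
  assumes free: "\<And>p q r u v w y. \<lbrakk>2 = p + q + r; y = p * u + q * v + r * w;
        u dvd 60; v dvd 60; w dvd 60; y dvd 60; P u = P y; P v = P y; P w = P y\<rbrakk> \<Longrightarrow> False"
  shows False
  using free[of 2 0 0 2 1 1 1] free[of 2 0 0 4 2 2 2] free[of 1 1 0 5 1 4 1]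
    free[of 1 1 0 4 1 3 1] free[of 1 1 0 5 2 3 2]
  by auto

theorem theorem4p2:
  fixes k l :: nat
  assumes "k \<ge> 2" and "l \<ge> 1"
  shows "f 2 k l \<le> enat (6 ^ l * k ^ l * (k + 1) ^ l * (k + 2) ^ l)"
proof -
  define M where "M = 6 * k * (k + 1) * (k + 2)"
  have n: "6 ^ l * k ^ l * (k + 1) ^ l * (k + 2) ^ l = M ^ l"
    by (simp only: M_def power_mult_distrib)
  have "has_mono_solution k l {1..M ^ l} \<Delta>" if col: "coloring 2 {1..M ^ l} \<Delta>" for \<Delta>
  proof (rule ccontr)
    assume none: "\<not> has_mono_solution k l {1..M ^ l} \<Delta>"
    \<comment> \<open>For \<open>k = 2\<close>, \<open>M\<close> is 144, which 5 does not divide; 60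
      has all the divisors 1 to 5 and lies below 144.\<close>
    define N where "N = (if k = 2 then 60 else M)"
    have N: "N > 0" "N \<le> M" using assms(1) by (auto simp: N_def M_def)
    define P where "P d \<longleftrightarrow> \<Delta> ((N div d) ^ l) = 0" for d
    have two: "\<Delta> ((N div d) ^ l) \<in> {0, 1}" if "d dvd N" for d
    proof -
      have "N div d > 0" using that N by (auto elim!: dvdE)
      moreover have "N div d \<le> M" using N(2) div_le_dividend le_trans by blast
      ultimately have "(N div d) ^ l \<in> {1..M ^ l}" by (simp add: Suc_le_eq power_mono)
      with col have "\<Delta> ((N div d) ^ l) \<in> {0..<2}" unfolding coloring_def by blast
      then show ?thesis by auto
    qed
    have free: False if "k = p + q + r" "y = p * u + q * v + r * w"
        and dvd: "u dvd N" "v dvd N" "w dvd N" "y dvd N"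
        and "P u = P y" "P v = P y" "P w = P y" for p q r u v w y
    proof -
      \<comment> \<open>The only colours are 0 and 1, so agreement under \<open>P\<close> is
        equality of colours.\<close>
      have "\<Delta> ((N div d) ^ l) = \<Delta> ((N div y) ^ l)" if "d \<in> {u, v, w}" for d
        using that \<open>P u = P y\<close> \<open>P v = P y\<close> \<open>P w = P y\<close> two[OF dvd(1)] two[OF dvd(2)]
          two[OF dvd(3)] two[OF dvd(4)]
        by (auto simp: P_def)
      then have "has_mono_solution k l {1..M ^ l} \<Delta>"
        using has_mono_solution_of_divisors[OF assms(2) N(1) power_mono[OF N(2)] that(1,2) dvd]
        by simp
      with none show False ..
    qed
    show False
    proof (cases "k = 2")
      case True
      then have "N = 60" by (simp add: N_def)
      show False by (rule two_coloring_divisors_sixty[of P]) (rule free[unfolded True \<open>N = 60\<close>])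
    next
      case False
      then have "k \<ge> 3" "N = 6 * k * (k + 1) * (k + 2)" using assms(1) by (auto simp: N_def M_def)
      then show False by (rule two_coloring_divisors[of k N P]) (rule free)
    qed
  qed
  \<comment> \<open>Thus \<open>M ^ l\<close> belongs to the set whose infimum defines
    \<open>f\<close>.\<close>
  moreover have "M ^ l \<ge> 1" using assms(1) by (simp add: M_def)
  ultimately show ?thesis
    unfolding n f_def by (intro Inf_lower imageI) simp
qed

end
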